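(* Let $A,B \in \mathbb{R}^{n \times n}$ and let $J$ be a nonempty proper subset of $\langle n \rangle = \{1,\dots,n\}$ (so $n \ge 2$). Then every matrix in the interval hull $\mathbb{I}(A,B)$ is an almost $P$-matrix of the first category with respect to $J$ if and only if $I_{P_J}$ is an almost $P$-matrix of the first category with respect to $J$ and $I_z$ is an almost $P$-matrix of the first category with respect to $J$ for all $z \in \{\pm 1\}^n$.
   Context: For $A=(a_{ij}), B=(b_{ij}) \in \mathbb{R}^{n\times n}$, the interval hull is $\mathbb{I}(A,B) = \{C \in \mathbb{R}^{n\times n} : c_{ij} = t_{ij} a_{ij} + (1-t_{ij}) b_{ij},\ t_{ij} \in [0,1]\}$, where the $t_{ij}$ are chosen independently for each entry. Define the $n \times n$ matrices $(I_u)_{ij} = \max\{a_{ij},b_{ij}\}$, $(I_l)_{ij} = \min\{a_{ij},b_{ij}\}$, $I_c = \frac{A+B}{2}$, $\Delta = \frac{I_u - I_l}{2}$. For $z=(z_1,\dots,z_n) \in \{\pm 1\}^n$, let $D_z = \mathrm{diag}(z_1,\dots,z_n)$ and $I_z = I_c - D_z \Delta D_z$. For a nonempty proper subset $J$ of $\langle n \rangle$, let $I_J$ be the diagonal $n \times n$ matrix whose $i$-th diagonal entry is $1$ if $i \in J$ and $-1$ if $i \notin J$, and let $I_{P_J} = I_c + I_J \Delta I_J$. A matrix $M \in \mathbb{R}^{n\times n}$ with $n \ge 2$ is an almost $P$-matrix if all its proper principal minors are positive and $\det M < 0$ (in particular $M$ is invertible). A real $n \times n$ matrix is an $N$-matrix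 if all its principal minors (including the determinant) are negative. Write $J^\complement = \langle n \rangle \setminus J$, and let $M_{KL}$ denote the submatrix of $M$ with rows indexed by $K$ and columns indexed by $L$; matrix inequalities are entrywise. An $N$-matrix $M \in \mathbb{R}^{n \times n}$ is of the first category with respect to $J$ if $M_{JJ} < 0$, $M_{J^\complement J^\complement} < 0$, $M_{J J^\complement} > 0$ and $M_{J^\complement J} > 0$. An almost $P$-matrix $M$ is of the first category with respect to $J$ if $M^{-1}$ is an $N$-matrix of the first category with respect to $J$. *)

theory Defs
  imports "HOL-Analysis.Analysis"
begin

section \<open>Principal minors\<close>

text \<open>
  The determinant of the principal submatrix with rows and columns indexed by \<open>K\<close>. Since
  \<open>K\<close> is a set and not a type, the library's \<open>det\<close> does not apply to this submatrix; the right-hand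
  side is the formula \<open>det_def\<close> with the index set \<open>UNIV\<close> replaced by \<open>K\<close>. The lemma
  \<open>principal_minor_eq_det\<close> confirms that for every enumeration of \<open>K\<close> by an index type
  this is the library determinant of the submatrix.
\<close>

definition principal_minor :: "real^'n^'n \<Rightarrow> 'n set \<Rightarrow> real" where
  "principal_minor M K = (\<Sum>p | p permutes K. of_int (sign p) * (\<Prod>i\<in>K. M $ i $ p i))"

lemma principal_minor_UNIV: "principal_minor M UNIV = det M"
  by (simp add: principal_minor_def det_def)

lemma principal_minor_eq_det:
  fixes M :: "real^'n^'n" and f :: "'k::finite \<Rightarrow> 'n"
  assumes "inj f"
  shows "principal_minor M (range f) = det (\<chi> i j. M $ f i $ f j)"
proof -
  define g where "g = inv_into UNIV f"
  have bf: "bij_betw f UNIV (range f)"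
    using assms by (simp add: bij_betw_def)
  have bg: "bij_betw g (range f) UNIV"
    unfolding g_def using bf by (rule bij_betw_inv_into)
  have gf: "g (f x) = x" for x
    using assms by (simp add: g_def)
  have fg: "f (g y) = y" if "y \<in> range f" for y
    using that by (simp add: g_def f_inv_into_f)
  have "det (\<chi> i j. M $ f i $ f j) =
      (\<Sum>p | p permutes UNIV. of_int (sign p) * (\<Prod>i\<in>UNIV. M $ f i $ f (p i)))"
    by (simp add: det_def)
  also have "\<dots> = (\<Sum>q | q permutes range f. of_int (sign q) * (\<Prod>i\<in>range f. M $ i $ q i))"
  proof (rule sum.reindex_bij_witness[where i = "map_permutation (range f) g"
        and j = "map_permutation UNIV f"])
    fix p :: "'k \<Rightarrow> 'k" assume "p \<in> {p. p permutes UNIV}"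
    then have p: "p permutes UNIV" by simp
    show "map_permutation (range f) g (map_permutation UNIV f p) = p"
      by (rule map_permutation_compose_inv[OF bf p]) (rule gf)
    show "map_permutation UNIV f p \<in> {q. q permutes range f}"
      using map_permutation_permutes[OF bf p] by simp
    have "sign (map_permutation UNIV f p) = sign p"
      by (rule sign_map_permutation) (use assms p in auto)
    moreover have "(\<Prod>i\<in>range f. M $ i $ map_permutation UNIV f p i)
        = (\<Prod>i\<in>UNIV. M $ f i $ f (p i))"
      using assms by (simp add: prod.reindex map_permutation_apply)
    ultimately show "of_int (sign (map_permutation UNIV f p)) *
        (\<Prod>i\<in>range f. M $ i $ map_permutation UNIV f p i)
        = (of_int (sign p) :: real) * (\<Prod>i\<in>UNIV. M $ f i $ f (p i))"
      by simp
  next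
    fix q :: "'n \<Rightarrow> 'n" assume "q \<in> {q. q permutes range f}"
    then have q: "q permutes range f" by simp
    show "map_permutation UNIV f (map_permutation (range f) g q) = q"
      by (rule map_permutation_compose_inv[OF bg q]) (rule fg)
    show "map_permutation (range f) g q \<in> {p. p permutes UNIV}"
      using map_permutation_permutes[OF bg q] by simp
  qed
  finally show ?thesis
    by (simp add: principal_minor_def)
qed


section \<open>Almost P-matrices, N-matrices and their first category\<close>

definition almost_P_matrix :: "real^'n^'n \<Rightarrow> bool" where
  "almost_P_matrix M \<longleftrightarrow> CARD('n) \<ge> 2 \<and>
     (\<forall>K. K \<noteq> {} \<and> K \<noteq> UNIV \<longrightarrow> principal_minor M K > 0) \<and> det M < 0"

definition N_matrix :: "real^'n^'n \<Rightarrow> bool" where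
  "N_matrix M \<longleftrightarrow> (\<forall>K. K \<noteq> {} \<longrightarrow> principal_minor M K < 0)"

definition N_matrix_first_category :: "'n set \<Rightarrow> real^'n^'n \<Rightarrow> bool" where
  "N_matrix_first_category J M \<longleftrightarrow> N_matrix M \<and>
     (\<forall>i\<in>J. \<forall>j\<in>J. M $ i $ j < 0) \<and>
     (\<forall>i\<in>-J. \<forall>j\<in>-J. M $ i $ j < 0) \<and>
     (\<forall>i\<in>J. \<forall>j\<in>-J. M $ i $ j > 0) \<and>
     (\<forall>i\<in>-J. \<forall>j\<in>J. M $ i $ j > 0)"

definition almost_P_matrix_first_category :: "'n set \<Rightarrow> real^'n^'n \<Rightarrow> bool" where
  "almost_P_matrix_first_category J M \<longleftrightarrow>
     almost_P_matrix M \<and> N_matrix_first_category J (matrix_inv M)"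


section \<open>Interval hulls\<close>

definition interval_hull :: "real^'n^'n \<Rightarrow> real^'n^'n \<Rightarrow> (real^'n^'n) set" where
  "interval_hull A B = {C. \<exists>t :: real^'n^'n. \<forall>i j. t $ i $ j \<in> {0..1} \<and>
     C $ i $ j = t $ i $ j * A $ i $ j + (1 - t $ i $ j) * B $ i $ j}"

definition I_upper :: "real^'n^'n \<Rightarrow> real^'n^'n \<Rightarrow> real^'n^'n" where
  "I_upper A B = (\<chi> i j. max (A $ i $ j) (B $ i $ j))"

definition I_lower :: "real^'n^'n \<Rightarrow> real^'n^'n \<Rightarrow> real^'n^'n" where
  "I_lower A B = (\<chi> i j. min (A $ i $ j) (B $ i $ j))"

definition I_center :: "real^'n^'n \<Rightarrow> real^'n^'n \<Rightarrow> real^'n^'n" where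
  "I_center A B = (1 / 2) *\<^sub>R (A + B)"

definition I_radius :: "real^'n^'n \<Rightarrow> real^'n^'n \<Rightarrow> real^'n^'n" where
  "I_radius A B = (1 / 2) *\<^sub>R (I_upper A B - I_lower A B)"

definition diag_matrix :: "real^'n \<Rightarrow> real^'n^'n" where
  "diag_matrix z = (\<chi> i j. if i = j then z $ i else 0)"

definition I_vec :: "real^'n^'n \<Rightarrow> real^'n^'n \<Rightarrow> real^'n \<Rightarrow> real^'n^'n" where
  "I_vec A B z = I_center A B - diag_matrix z ** I_radius A B ** diag_matrix z"

definition signature_matrix :: "'n set \<Rightarrow> real^'n^'n" where
  "signature_matrix J = diag_matrix (\<chi> i. if i \<in> J then 1 else -1)"

definition I_P :: "real^'n^'n \<Rightarrow> real^'n^'n \<Rightarrow> 'n set \<Rightarrow> real^'n^'n" where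
  "I_P A B J = I_center A B + signature_matrix J ** I_radius A B ** signature_matrix J"

end

theory Submission
  imports Defs
begin

text \<open>
  Let \<open>s\<close> be the sign vector of \<open>J\<close>. The map \<open>F M = - D\<^sub>s M D\<^sub>s\<close> turns first category into
  entrywise positivity of the inverse and sends the hull into the order interval between
  \<open>F (I_P A B J)\<close> and \<open>F I\<^sub>s\<close>, so Kuttler's theorem on inverse-positive matrices handles the inverse of
  every \<open>C\<close> in the hull. In particular the determinant has no zero on the hull and keeps the sign it
  has at \<open>I\<^sub>s\<close>. Proper principal minors are controlled by the sign non-reversal characterisation of
  P-matrices, where for each \<open>x\<close> the worst matrix of the hull is \<open>I\<^sub>z\<close> with \<open>z = sgn x\<close>. That \<open>C\<^sup>-\<^sup>1\<close>
  is an N-matrix is automatic for an almost P-matrix \<open>C\<close>, by Jacobi's complementary minor identity.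
\<close>

section \<open>Principal minors as determinants\<close>

lemma matrix_inv_inverse:
  fixes M :: "'a::semiring_1^'n^'n"
  assumes "invertible M"
  shows "M ** matrix_inv M = mat 1" "matrix_inv M ** M = mat 1"
proof -
  have "\<exists>N. M ** N = mat 1 \<and> N ** M = mat 1"
    using assms by (simp add: invertible_def)
  then have "M ** matrix_inv M = mat 1 \<and> matrix_inv M ** M = mat 1"
    unfolding matrix_inv_def by (rule someI_ex)
  then show "M ** matrix_inv M = mat 1" "matrix_inv M ** M = mat 1" by auto
qed

lemma det_nonzero_iff_ker:
  fixes M :: "real^'n^'n"
  shows "det M \<noteq> 0 \<longleftrightarrow> (\<forall>x. M *v x = 0 \<longrightarrow> x = 0)"
  by (metis invertible_det_nz invertible_left_inverse matrix_left_invertible_ker)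

text \<open>Completing the rows indexed by \<open>K\<close> with rows of the identity keeps the
  index type, so that a principal minor becomes a \<open>det\<close> and \<open>det_mul\<close>,
  kernels and continuity apply to it.\<close>

definition pad_rows :: "'n set \<Rightarrow> real^'n^'n \<Rightarrow> real^'n^'n" where
  "pad_rows K M = (\<chi> i. if i \<in> K then M $ i else axis i 1)"

text \<open>A permutation that moves some index outside \<open>K\<close> picks up a zero from an
  identity row, so only the permutations of \<open>K\<close> contribute to the Leibniz sum.\<close>

lemma det_pad_rows: "det (pad_rows K M) = principal_minor M K"
proof -
  have "(\<Prod>i\<in>UNIV. pad_rows K M $ i $ p i) = (\<Prod>i\<in>K. M $ i $ p i)" if "p permutes K" for p
  proof -
    have "(\<Prod>i\<in>UNIV. pad_rows K M $ i $ p i) = (\<Prod>i\<in>K. pad_rows K M $ i $ p i)"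
      by (rule prod.mono_neutral_right)
        (use that in \<open>auto simp: pad_rows_def axis_def permutes_not_in\<close>)
    then show ?thesis by (simp add: pad_rows_def)
  qed
  moreover have "(\<Prod>i\<in>UNIV. pad_rows K M $ i $ p i) = 0"
    if "p permutes UNIV" "\<not> p permutes K" for p
  proof -
    have "\<exists>i. i \<notin> K \<and> p i \<noteq> i"
      using that permutes_superset[OF that(1), of K] by auto
    then obtain i where "i \<notin> K" "p i \<noteq> i" by blast
    then have "pad_rows K M $ i $ p i = 0" by (simp add: pad_rows_def axis_def)
    then show ?thesis by (intro prod_zero) auto
  qed
  moreover have "{p. p permutes K} \<subseteq> {p. p permutes UNIV}"
    using permutes_subset by blast
  ultimately show ?thesis
    unfolding det_def principal_minor_def
    by (intro sum.mono_neutral_cong_right) auto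
qed

lemma pad_rows_mult_vec:
  "(pad_rows K M *v x) $ i = (if i \<in> K then (M *v x) $ i else x $ i)"
  by (simp add: matrix_vector_mult_def pad_rows_def axis_def mult_delta_left)

text \<open>In \<open>pad_rows K N ** M\<close> the rows in \<open>K\<close> become rows of
  \<open>N ** M = mat 1\<close> and the others become rows of \<open>M\<close>. This is
  \<open>pad_rows (- K) M\<close>; taking determinants gives the identity.\<close>

lemma jacobi_complementary_minor:
  fixes M N :: "real^'n^'n"
  assumes "N ** M = mat 1"
  shows "principal_minor N K * det M = principal_minor M (- K)"
proof -
  have "pad_rows K N ** M = pad_rows (- K) M"
  proof -
    have "(pad_rows K N ** M) $ i $ j = pad_rows (- K) M $ i $ j" for i j
    proof (cases "i \<in> K")
      case True
      then have "(pad_rows K N ** M) $ i $ j = (N ** M) $ i $ j"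
        by (simp add: matrix_matrix_mult_def pad_rows_def)
      then show ?thesis using True by (auto simp: assms pad_rows_def mat_def axis_def)
    qed (simp add: matrix_matrix_mult_def pad_rows_def axis_def mult_delta_left)
    then show ?thesis by (simp add: vec_eq_iff)
  qed
  then show ?thesis by (metis det_pad_rows det_mul)
qed

lemma principal_minor_empty [simp]: "principal_minor M {} = 1"
  by (simp add: principal_minor_def)

lemma N_matrix_matrix_inv:
  fixes M :: "real^'n^'n"
  assumes "almost_P_matrix M"
  shows "N_matrix (matrix_inv M)"
  unfolding N_matrix_def
proof (intro allI impI)
  fix K :: "'n set"
  assume "K \<noteq> {}"
  have "det M < 0" using assms by (simp add: almost_P_matrix_def)
  have "- K \<noteq> UNIV" using \<open>K \<noteq> {}\<close> by auto
  \<comment> \<open>For \<open>K = UNIV\<close> the complementary minor is the empty one, which is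
    1.\<close>
  then have "principal_minor M (- K) > 0"
    using assms by (cases "- K = {}") (simp_all add: almost_P_matrix_def)
  moreover have "principal_minor (matrix_inv M) K * det M = principal_minor M (- K)"
    using \<open>det M < 0\<close> by (intro jacobi_complementary_minor matrix_inv_inverse)
      (simp add: invertible_det_nz)
  ultimately show "principal_minor (matrix_inv M) K < 0"
    using \<open>det M < 0\<close> by (metis zero_less_mult_iff less_asym)
qed


section \<open>The sign non-reversal property\<close>

lemma principal_minor_cong:
  assumes "\<And>i j. i \<in> K \<Longrightarrow> j \<in> K \<Longrightarrow> M $ i $ j = N $ i $ j"
  shows "principal_minor M K = principal_minor N K"
  unfolding principal_minor_def
  by (intro sum.cong prod.cong arg_cong2[where f = "(*)"] refl)
    (use assms permutes_in_image in fastforce)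

text \<open>The Leibniz sum is affine in a diagonal entry. Its slope collects the permutations of
  \<open>K\<close> that fix \<open>i\<close>, which are exactly the permutations of
  \<open>K - {i}\<close>.\<close>

lemma principal_minor_add_diag_entry:
  fixes M :: "real^'n^'n"
  assumes "i \<in> K"
  shows "principal_minor (\<chi> a b. M $ a $ b + (if a = i \<and> b = i then d else 0)) K
    = principal_minor M K + d * principal_minor M (K - {i})"
proof -
  let ?N = "\<chi> a b. M $ a $ b + (if a = i \<and> b = i then d else 0)"
  let ?R = "\<lambda>p. \<Prod>a\<in>K - {i}. M $ a $ p a"
  have prod: "(\<Prod>a\<in>K. X $ a $ p a) = X $ i $ p i * (\<Prod>a\<in>K - {i}. X $ a $ p a)"
    for X :: "real^'n^'n" and p
    using assms by (intro prod.remove) auto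
  have split: "of_int (sign p) * (\<Prod>a\<in>K. ?N $ a $ p a) = of_int (sign p) * (\<Prod>a\<in>K. M $ a $ p a)
      + (if p i = i then d * (of_int (sign p) * ?R p) else 0)" for p
  proof -
    have "(\<Prod>a\<in>K - {i}. ?N $ a $ p a) = ?R p" by (intro prod.cong) auto
    then have "(\<Prod>a\<in>K. ?N $ a $ p a) = ?N $ i $ p i * ?R p" by (simp only: prod)
    then show ?thesis by (simp add: prod[of M] algebra_simps)
  qed
  have "p permutes K - {i} \<longleftrightarrow> p permutes K \<and> p i = i" for p
  proof
    assume "p permutes K - {i}"
    then show "p permutes K \<and> p i = i" by (auto intro: permutes_subset simp: permutes_not_in)
  next
    assume "p permutes K \<and> p i = i"
    then show "p permutes K - {i}" by (auto intro: permutes_superset)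
  qed
  then have "{p. p permutes K - {i}} = {p \<in> {p. p permutes K}. p i = i}" by simp
  then have "(\<Sum>p | p permutes K. if p i = i then d * (of_int (sign p) * ?R p) else 0)
      = (\<Sum>p | p permutes K - {i}. d * (of_int (sign p) * ?R p))"
    by (simp only: sum.inter_filter[OF finite_permutations[OF finite]])
  then show ?thesis
    unfolding principal_minor_def split by (simp add: sum.distrib sum_distrib_left)
qed

lemma principal_minor_add_diag_pos:
  fixes M :: "real^'n^'n"
  assumes "\<And>L. L \<subseteq> K \<Longrightarrow> principal_minor M L > 0" and "\<And>i. d i \<ge> 0" and "L \<subseteq> K"
  shows "principal_minor (\<chi> a b. M $ a $ b + (if a = b then d a else 0)) L > 0"
proof -
  \<comment> \<open>The diagonal is raised one entry at a time, \<open>F\<close> being the set of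
    entries already raised. \<open>L\<close> stays arbitrary because each step also needs the minor
    on \<open>L - {i}\<close>.\<close>
  have "finite F \<Longrightarrow> L \<subseteq> K \<Longrightarrow>
      principal_minor (\<chi> a b. M $ a $ b + (if a = b \<and> a \<in> F then d a else 0)) L > 0" for F L
  proof (induction F arbitrary: L rule: finite_induct)
    case empty
    have "(\<chi> a b. M $ a $ b + (if a = b \<and> a \<in> {} then d a else 0)) = M"
      by (simp add: vec_eq_iff)
    with empty assms(1) show ?case by metis
  next
    case (insert i F)
    let ?M = "\<lambda>F. \<chi> a b. M $ a $ b + (if a = b \<and> a \<in> F then d a else 0)"
    show ?case
    proof (cases "i \<in> L")
      case True
      have "?M (insert i F) = (\<chi> a b. ?M F $ a $ b + (if a = i \<and> b = i then d i else 0))"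
        using insert.hyps by (auto simp: vec_eq_iff)
      then have "principal_minor (?M (insert i F)) L
          = principal_minor (?M F) L + d i * principal_minor (?M F) (L - {i})"
        using principal_minor_add_diag_entry[OF True] by metis
      moreover have "principal_minor (?M F) L > 0" "principal_minor (?M F) (L - {i}) > 0"
        using insert.prems by (auto intro!: insert.IH)
      ultimately show ?thesis using assms(2)[of i] by (simp add: add_pos_nonneg)
    next
      case False
      then have "principal_minor (?M (insert i F)) L = principal_minor (?M F) L"
        by (intro principal_minor_cong) auto
      then show ?thesis using insert by simp
    qed
  qed
  from this[of UNIV L] show ?thesis using assms(3) by simp
qed

text \<open>If no product were positive, a nonnegative diagonal could be added to \<open>M\<close>
  so that \<open>x\<close> is annihilated on its support. Such an addition keeps the minors
  positive, hence nonzero.\<close>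

lemma sign_nonreversal:
  fixes M :: "real^'n^'n"
  assumes minors: "\<And>L. L \<subseteq> K \<Longrightarrow> principal_minor M L > 0"
    and "x \<noteq> 0" and supp: "\<And>i. i \<notin> K \<Longrightarrow> x $ i = 0"
  shows "\<exists>i. x $ i * (M *v x) $ i > 0"
proof (rule ccontr)
  assume "\<not> ?thesis"
  then have le: "x $ i * (M *v x) $ i \<le> 0" for i by (simp add: not_less)
  define L where "L = {i. x $ i \<noteq> 0}"
  define d where "d i = (if x $ i = 0 then 0 else - (M *v x) $ i / x $ i)" for i
  let ?N = "\<chi> a b. M $ a $ b + (if a = b then d a else 0)"
  have d: "d i \<ge> 0" for i
    using le[of i] by (auto simp: d_def divide_simps mult_le_0_iff)
  have "principal_minor ?N L > 0"
    by (rule principal_minor_add_diag_pos[OF minors d]) (use supp in \<open>auto simp: L_def\<close>)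
  then have "det (pad_rows L ?N) \<noteq> 0" by (simp add: det_pad_rows)
  moreover have "pad_rows L ?N *v x = 0"
  proof -
    have "(?N *v x) $ i = (M *v x) $ i + d i * x $ i" for i
      by (simp add: matrix_vector_mult_def sum.distrib distrib_right mult_delta_left)
    then show ?thesis
      by (auto simp: vec_eq_iff pad_rows_mult_vec L_def d_def)
  qed
  ultimately show False using \<open>x \<noteq> 0\<close> det_nonzero_iff_ker by blast
qed

lemma det_same_sign_segment:
  fixes M N :: "real^'n^'n"
  assumes "\<And>t. 0 \<le> t \<Longrightarrow> t \<le> 1 \<Longrightarrow> det ((1 - t) *\<^sub>R M + t *\<^sub>R N) \<noteq> 0"
  shows "det M * det N > 0"
proof (rule ccontr)
  let ?f = "\<lambda>t. det ((1 - t) *\<^sub>R M + t *\<^sub>R N)"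
  assume "\<not> ?thesis"
  then have "0 \<in> closed_segment (?f 0) (?f 1)"
    by (auto simp: closed_segment_eq_real_ivl mult_le_0_iff not_less)
  moreover have "continuous_on (closed_segment 0 1) ?f"
    unfolding det_def by (auto intro!: continuous_intros)
  ultimately obtain t where "t \<in> closed_segment 0 1" "?f t = 0"
    using IVT'_closed_segment_real[of 0 ?f 0 1] by blast
  then show False using assms by (auto simp: closed_segment_eq_real_ivl)
qed

text \<open>The segment from the identity to \<open>pad_rows K M\<close> contains no singular
  matrix, so the determinant keeps the sign it has at the identity. A kernel vector \<open>x\<close>
  would vanish off \<open>K\<close> and satisfy
  \<open>(1 - t) x\<^sub>i\<^sup>2 + t x\<^sub>i (M x)\<^sub>i = 0\<close> on
  \<open>K\<close>.\<close>

lemma principal_minor_pos_if_sign_nonreversal: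
  fixes M :: "real^'n^'n"
  assumes "\<And>x. x \<noteq> 0 \<Longrightarrow> (\<And>i. i \<notin> K \<Longrightarrow> x $ i = 0) \<Longrightarrow> \<exists>i. x $ i * (M *v x) $ i > 0"
  shows "principal_minor M K > 0"
proof -
  have "det ((1 - t) *\<^sub>R mat 1 + t *\<^sub>R pad_rows K M) \<noteq> 0" if "0 \<le> t" "t \<le> 1" for t
    unfolding det_nonzero_iff_ker
  proof (intro allI impI, rule ccontr)
    fix x
    assume "((1 - t) *\<^sub>R mat 1 + t *\<^sub>R pad_rows K M) *v x = 0" and "x \<noteq> 0"
    then have eq: "(1 - t) * x $ i + t * (pad_rows K M *v x) $ i = 0" for i
      by (simp add: matrix_vector_mult_add_rdistrib scaleR_matrix_vector_assoc[symmetric] vec_eq_iff)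
    have "x $ i = 0" if "i \<notin> K" for i
      using eq[of i] that by (simp add: pad_rows_mult_vec algebra_simps)
    then obtain i where i: "x $ i * (M *v x) $ i > 0"
      using assms \<open>x \<noteq> 0\<close> by blast
    then have "i \<in> K" using \<open>\<And>i. i \<notin> K \<Longrightarrow> x $ i = 0\<close> by fastforce
    then have "(1 - t) * (x $ i * x $ i) + t * (x $ i * (M *v x) $ i) = 0"
      using eq[of i] by (simp add: pad_rows_mult_vec) algebra
    moreover have "x $ i * x $ i > 0" using i by (auto simp: zero_less_mult_iff)
    ultimately show False
      using i that by (smt (verit) mult_nonneg_nonneg mult_pos_pos)
  qed
  from det_same_sign_segment[OF this] show ?thesis by (simp add: det_pad_rows)
qed

section \<open>Inverse-positive matrices\<close>

text \<open>Let \<open>m\<close> be the least ratio of \<open>y\<close> to \<open>v\<close>,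
  attained at \<open>k\<close>. Then \<open>m (T v)\<^sub>k \<le> (T y)\<^sub>k \<le> y\<^sub>k = m
  v\<^sub>k\<close>, and \<open>(T v)\<^sub>k < v\<^sub>k\<close> forces
  \<open>m \<ge> 0\<close>.\<close>

lemma nonneg_if_diagonally_dominated:
  fixes T :: "real^'n^'n"
  assumes T: "\<And>i j. T $ i $ j \<ge> 0" and v: "\<And>i. v $ i > 0"
    and vT: "\<And>i. (T *v v) $ i < v $ i" and y: "\<And>i. (T *v y) $ i \<le> y $ i"
  shows "y $ i \<ge> 0"
proof -
  define m where "m = Min (range (\<lambda>i. y $ i / v $ i))"
  have "m \<in> range (\<lambda>i. y $ i / v $ i)" unfolding m_def by (intro Min_in) auto
  then obtain k where "m = y $ k / v $ k" by blast
  then have k: "y $ k = m * v $ k" using v[of k] by simp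
  have ge: "m * v $ j \<le> y $ j" for j
  proof -
    have "m \<le> y $ j / v $ j" unfolding m_def by (intro Min_le) auto
    then show ?thesis using v[of j] by (simp add: field_simps)
  qed
  have "m * (T *v v) $ k = (\<Sum>j\<in>UNIV. T $ k $ j * (m * v $ j))"
    by (simp add: matrix_vector_mult_def sum_distrib_left mult_ac)
  also have "\<dots> \<le> (T *v y) $ k"
    unfolding matrix_vector_mult_def by (auto intro!: sum_mono mult_left_mono ge T)
  also have "\<dots> \<le> m * v $ k" using y[of k] k by simp
  finally have "0 \<le> m * (v $ k - (T *v v) $ k)" by (simp add: algebra_simps)
  then have "m \<ge> 0" using vT[of k] by (simp add: zero_le_mult_iff)
  then show ?thesis using ge[of i] v[of i] by (meson order_trans mult_nonneg_nonneg less_imp_le)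
qed

lemma matrix_mult_nonneg:
  fixes M N :: "real^'n^'n"
  assumes "\<And>i j. M $ i $ j \<ge> 0" "\<And>i j. N $ i $ j \<ge> 0"
  shows "(M ** N) $ i $ j \<ge> 0"
  by (simp add: matrix_matrix_mult_def sum_nonneg assms)

text \<open>Kuttler's theorem. With \<open>v = P\<^sup>-\<^sup>1 1\<close> the nonnegative matrix \<open>T = Q\<^sup>-\<^sup>1 (Q - X)\<close> satisfies
  \<open>T v < v\<close>, so \<open>Q\<^sup>-\<^sup>1 X = 1 - T\<close> is monotone.\<close>

lemma inverse_positive_between:
  fixes P X Q P' Q' :: "real^'n^'n"
  assumes P: "P ** P' = mat 1" and Q: "Q ** Q' = mat 1"
    and P'pos: "\<And>i j. P' $ i $ j > 0" and Q'pos: "\<And>i j. Q' $ i $ j > 0"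
    and PX: "\<And>i j. P $ i $ j \<le> X $ i $ j" and XQ: "\<And>i j. X $ i $ j \<le> Q $ i $ j"
  shows "invertible X \<and> (\<forall>i j. matrix_inv X $ i $ j > 0)"
proof -
  define v where "v = P' *v 1"
  define T where "T = Q' ** (Q - X)"
  have v: "v $ i > 0" for i
    unfolding v_def matrix_vector_mult_def by (auto intro!: sum_pos P'pos)
  have Q': "Q' ** Q = mat 1" using Q matrix_left_right_inverse by blast
  have T: "T $ i $ j \<ge> 0" for i j
    unfolding T_def by (rule matrix_mult_nonneg) (auto simp: XQ Q'pos less_imp_le)
  have Tx: "T *v x = x - Q' *v (X *v x)" for x
    by (simp add: T_def matrix_vector_mul_assoc[symmetric] matrix_vector_mult_diff_rdistrib
        matrix_vector_mult_diff_distrib) (simp add: matrix_vector_mul_assoc Q')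
  have Xv: "(X *v v) $ i > 0" for i
  proof -
    have "P *v v = 1" by (simp add: v_def matrix_vector_mul_assoc P)
    then have "1 = (P *v v) $ i" by simp
    also have "\<dots> \<le> (X *v v) $ i"
      unfolding matrix_vector_mult_def
      by (auto intro!: sum_mono mult_right_mono PX less_imp_le[OF v])
    finally show ?thesis by simp
  qed
  have Tv: "(T *v v) $ i < v $ i" for i
  proof -
    have "(Q' *v (X *v v)) $ i > 0"
      unfolding matrix_vector_mult_def[of Q'] by (auto intro!: sum_pos mult_pos_pos Q'pos Xv)
    then show ?thesis by (simp add: Tx)
  qed
  have mono: "y $ i \<ge> 0" if y: "\<And>i. (X *v y) $ i \<ge> 0" for y i
  proof (rule nonneg_if_diagonally_dominated[OF T v Tv])
    fix i
    have "(Q' *v (X *v y)) $ i \<ge> 0"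
      unfolding matrix_vector_mult_def[of Q'] by (auto intro!: sum_nonneg simp: y Q'pos less_imp_le)
    then show "(T *v y) $ i \<le> y $ i" by (simp add: Tx)
  qed
  \<comment> \<open>Monotonicity applied to both \<open>x\<close> and \<open>- x\<close> makes the
    kernel trivial.\<close>
  have "x = 0" if "X *v x = 0" for x
  proof -
    have "x $ i \<ge> 0" for i by (rule mono) (simp add: that)
    moreover have "(- x) $ i \<ge> 0" for i
    proof (rule mono)
      have "X *v (- x) = 0"
        using that matrix_vector_mult_diff_distrib[of X 0 x] by simp
      then show "(X *v (- x)) $ i \<ge> 0" for i by simp
    qed
    ultimately show ?thesis by (simp add: vec_eq_iff) (meson order_antisym)
  qed
  then have inv: "invertible X" using det_nonzero_iff_ker invertible_det_nz by blast
  let ?Y = "matrix_inv X"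
  note Y = matrix_inv_inverse[OF inv]
  have nonneg: "?Y $ i $ j \<ge> 0" for i j
  proof -
    have col: "X *v column j ?Y = axis j 1"
      by (simp only: matrix_vector_mult_basis[symmetric] matrix_vector_mul_assoc Y
          matrix_vector_mul_lid)
    have "column j ?Y $ i \<ge> 0" by (rule mono) (simp add: col axis_def)
    then show ?thesis by (simp add: column_def)
  qed
  \<comment> \<open>This resolvent identity bounds the nonnegative \<open>?Y\<close> below by
    \<open>Q'\<close>, which upgrades it to strict positivity.\<close>
  have "?Y - Q' = ?Y ** (Q - X) ** Q'"
  proof -
    have "?Y ** (Q - X) = ?Y ** Q - mat 1"
      by (simp flip: Y(2) add: matrix_eq matrix_vector_mul_assoc[symmetric]
          matrix_vector_mult_diff_rdistrib matrix_vector_mult_diff_distrib)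
    moreover have "(?Y ** Q - mat 1) ** Q' = ?Y - Q'"
      by (simp add: matrix_eq matrix_vector_mul_assoc[symmetric]
          matrix_vector_mult_diff_rdistrib) (simp add: matrix_vector_mul_assoc Q)
    ultimately show ?thesis by simp
  qed
  moreover have "(?Y ** (Q - X) ** Q') $ i $ j \<ge> 0" for i j
    by (intro matrix_mult_nonneg) (auto simp: nonneg XQ Q'pos less_imp_le)
  ultimately have "?Y $ i $ j \<ge> Q' $ i $ j" for i j
    by (metis diff_ge_0_iff_ge vector_minus_component)
  then have "?Y $ i $ j > 0" for i j
    using Q'pos less_le_trans by blast
  with inv show ?thesis by blast
qed

section \<open>Interval hulls\<close>

lemma diag_matrix_sandwich:
  "(diag_matrix z ** M ** diag_matrix z) $ i $ j = z $ i * z $ j * M $ i $ j"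
proof -
  have "(diag_matrix z ** M) $ i $ k = z $ i * M $ i $ k" for k
    by (simp add: matrix_matrix_mult_def diag_matrix_def mult_delta_left)
  then show ?thesis
    unfolding matrix_matrix_mult_def[of "diag_matrix z ** M"]
    by (simp add: diag_matrix_def[of z] mult_delta_right cong: if_cong)
qed

lemma I_vec_nth:
  "I_vec A B z $ i $ j = I_center A B $ i $ j - z $ i * z $ j * I_radius A B $ i $ j"
  by (simp add: I_vec_def diag_matrix_sandwich)

lemma I_P_nth:
  "I_P A B J $ i $ j = I_center A B $ i $ j
    + (if i \<in> J then 1 else -1) * (if j \<in> J then 1 else -1) * I_radius A B $ i $ j"
  unfolding I_P_def signature_matrix_def by (simp add: diag_matrix_sandwich)

lemma I_radius_nonneg: "I_radius A B $ i $ j \<ge> 0"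
  by (simp add: I_radius_def I_upper_def I_lower_def)

text \<open>The weights are chosen independently for each entry, so the hull is a box: each entry
  ranges over the interval with the given center and radius.\<close>

lemma mem_interval_hull_iff:
  "C \<in> interval_hull A B \<longleftrightarrow> (\<forall>i j. \<bar>C $ i $ j - I_center A B $ i $ j\<bar> \<le> I_radius A B $ i $ j)"
proof -
  have *: "(\<exists>t\<in>{0..1}. c = t * a + (1 - t) * b) \<longleftrightarrow> c \<in> closed_segment b a" for a b c :: real
    by (auto simp: in_segment add.commute)
  have "C \<in> interval_hull A B \<longleftrightarrow> (\<forall>i j. \<exists>t\<in>{0..1}. C $ i $ j = t * A $ i $ j + (1 - t) * B $ i $ j)"
    (is "_ \<longleftrightarrow> ?R")
  proof
    assume ?R
    then obtain t where "\<And>i j. t i j \<in> {0..1} \<and> C $ i $ j = t i j * A $ i $ j + (1 - t i j) * B $ i $ j"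
      by metis
    then show "C \<in> interval_hull A B"
      unfolding interval_hull_def by (auto intro!: exI[of _ "\<chi> i j. t i j"])
  qed (auto simp: interval_hull_def)
  also have "\<dots> \<longleftrightarrow> (\<forall>i j. C $ i $ j \<in> closed_segment (B $ i $ j) (A $ i $ j))"
    by (simp add: *)
  also have "\<dots> \<longleftrightarrow> (\<forall>i j. \<bar>C $ i $ j - I_center A B $ i $ j\<bar> \<le> I_radius A B $ i $ j)"
    by (intro iff_allI)
      (auto simp: closed_segment_eq_real_ivl I_center_def I_radius_def I_upper_def I_lower_def
        abs_le_iff max_def min_def field_simps)
  finally show ?thesis .
qed

lemma convex_interval_hull:
  assumes "C \<in> interval_hull A B" "D \<in> interval_hull A B" "0 \<le> t" "t \<le> 1"
  shows "(1 - t) *\<^sub>R C + t *\<^sub>R D \<in> interval_hull A B"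
  unfolding mem_interval_hull_iff
proof (intro allI)
  fix i j
  let ?c = "I_center A B $ i $ j" and ?r = "I_radius A B $ i $ j"
  have "\<bar>C $ i $ j - ?c\<bar> \<le> ?r" "\<bar>D $ i $ j - ?c\<bar> \<le> ?r"
    using assms by (auto simp: mem_interval_hull_iff)
  then have "C $ i $ j \<in> cball ?c ?r" "D $ i $ j \<in> cball ?c ?r"
    by (auto simp: dist_real_def abs_minus_commute)
  then have "(1 - t) *\<^sub>R C $ i $ j + t *\<^sub>R D $ i $ j \<in> cball ?c ?r"
    using assms(3,4) by (intro convexD[OF convex_cball]) auto
  then show "\<bar>((1 - t) *\<^sub>R C + t *\<^sub>R D) $ i $ j - ?c\<bar> \<le> ?r"
    by (simp add: dist_real_def abs_minus_commute)
qed

lemma I_P_in_interval_hull: "I_P A B J \<in> interval_hull A B"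
  by (auto simp: mem_interval_hull_iff I_P_nth I_radius_nonneg)

lemma I_vec_in_interval_hull:
  assumes "\<forall>i. z $ i \<in> {-1, 1}"
  shows "I_vec A B z \<in> interval_hull A B"
  unfolding mem_interval_hull_iff
proof (intro allI)
  fix i j
  have "z $ i = 1 \<or> z $ i = -1" "z $ j = 1 \<or> z $ j = -1" using assms by auto
  then show "\<bar>I_vec A B z $ i $ j - I_center A B $ i $ j\<bar> \<le> I_radius A B $ i $ j"
    by (auto simp: I_vec_nth I_radius_nonneg)
qed

text \<open>Rohn's reduction: \<open>I\<^sub>z\<close> with \<open>z = sgn x\<close> minimises every \<open>x\<^sub>i (C x)\<^sub>i\<close> over the hull.\<close>

lemma principal_minor_interval_hull_pos:
  fixes A B C :: "real^'n^'n"
  assumes C: "C \<in> interval_hull A B"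
    and pos: "\<And>z L. (\<forall>i. z $ i \<in> {-1, 1}) \<Longrightarrow> L \<subseteq> K \<Longrightarrow> principal_minor (I_vec A B z) L > 0"
  shows "principal_minor C K > 0"
proof (rule principal_minor_pos_if_sign_nonreversal)
  fix x :: "real^'n"
  assume x: "x \<noteq> 0" "\<And>i. i \<notin> K \<Longrightarrow> x $ i = 0"
  \<comment> \<open>Zero entries get the sign 1, since \<open>z\<close> must lie in
    \<open>{-1, 1}\<close>; \<open>z\<^sub>k x\<^sub>k = \<bar>x\<^sub>k\<bar>\<close> still holds
    there.\<close>
  define z :: "real^'n" where "z = (\<chi> i. if x $ i \<ge> 0 then 1 else -1)"
  have z: "\<forall>i. z $ i \<in> {-1, 1}" by (simp add: z_def)
  obtain i where i: "x $ i * (I_vec A B z *v x) $ i > 0"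
    using sign_nonreversal[OF pos[OF z] x] by blast
  have "x $ i * (I_vec A B z $ i $ j * x $ j) \<le> x $ i * (C $ i $ j * x $ j)" for j
  proof -
    let ?c = "I_center A B $ i $ j" and ?r = "I_radius A B $ i $ j"
    have zx: "z $ k * x $ k = \<bar>x $ k\<bar>" for k by (simp add: z_def)
    have "x $ i * ((?c - C $ i $ j) * x $ j) \<le> \<bar>x $ i * ((?c - C $ i $ j) * x $ j)\<bar>" by simp
    also have "\<dots> = \<bar>C $ i $ j - ?c\<bar> * (\<bar>x $ i\<bar> * \<bar>x $ j\<bar>)"
      by (simp add: abs_mult abs_minus_commute mult_ac)
    also have "\<dots> \<le> ?r * (\<bar>x $ i\<bar> * \<bar>x $ j\<bar>)"
      using C by (intro mult_right_mono) (auto simp: mem_interval_hull_iff)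
    also have "\<dots> = x $ i * ((z $ i * z $ j * ?r) * x $ j)"
      by (simp add: zx[symmetric] mult_ac)
    finally show ?thesis by (simp add: I_vec_nth algebra_simps)
  qed
  then have "x $ i * (I_vec A B z *v x) $ i \<le> x $ i * (C *v x) $ i"
    by (simp add: matrix_vector_mult_def sum_distrib_left sum_mono)
  then show "\<exists>i. x $ i * (C *v x) $ i > 0" using i by (intro exI[of _ i]) simp
qed

theorem theorem4p5:
  fixes A B :: "real^'n^'n" and J :: "'n set"
  assumes "J \<noteq> {}" and "J \<noteq> UNIV"
  shows "(\<forall>C\<in>interval_hull A B. almost_P_matrix_first_category J C) \<longleftrightarrow>
         (almost_P_matrix_first_category J (I_P A B J) \<and>
          (\<forall>z :: real^'n. (\<forall>i. z $ i \<in> {-1, 1}) \<longrightarrow>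
             almost_P_matrix_first_category J (I_vec A B z)))"
proof (intro iffI ballI)
  assume *: "almost_P_matrix_first_category J (I_P A B J) \<and>
          (\<forall>z :: real^'n. (\<forall>i. z $ i \<in> {-1, 1}) \<longrightarrow>
             almost_P_matrix_first_category J (I_vec A B z))"
  define s :: "real^'n" where "s = (\<chi> i. if i \<in> J then 1 else -1)"
  define F where "F M = (\<chi> i j. - (s $ i * s $ j * M $ i $ j))" for M :: "real^'n^'n"
  have s: "\<forall>i. s $ i \<in> {-1, 1}" and ss: "s $ i * s $ i = 1" for i
    by (auto simp: s_def)
  have ss': "s $ i * (s $ i * a) = a" for i a
    by (simp add: s_def)
  have F_mult: "F M ** F N = mat 1" if "M ** N = mat 1" for M N
  proof -
    have "(F M ** F N) $ i $ j = s $ i * s $ j * (M ** N) $ i $ j" for i j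
      by (simp add: F_def matrix_matrix_mult_def sum_distrib_left mult_ac ss')
    then show ?thesis by (simp add: that vec_eq_iff mat_def ss)
  qed
  have F_F: "F (F M) = M" for M
    by (simp add: F_def vec_eq_iff mult_ac ss')
  \<comment> \<open>The N-matrix condition on the inverse is dropped because it follows from
    \<open>almost_P_matrix M\<close>; the four sign blocks merge into positivity of
    \<open>F (matrix_inv M)\<close>.\<close>
  have first_category_iff: "almost_P_matrix_first_category J M \<longleftrightarrow>
      almost_P_matrix M \<and> (\<forall>i j. F (matrix_inv M) $ i $ j > 0)" for M
    unfolding almost_P_matrix_first_category_def N_matrix_first_category_def
    using N_matrix_matrix_inv[of M] by (auto simp: F_def s_def split: if_splits)
  have inv: "invertible M" if "almost_P_matrix M" for M :: "real^'n^'n"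
    using that by (simp add: almost_P_matrix_def invertible_det_nz)
  let ?U = "I_P A B J" and ?L = "I_vec A B s"
  have U: "almost_P_matrix ?U" "\<And>i j. F (matrix_inv ?U) $ i $ j > 0"
    and L: "almost_P_matrix ?L" "\<And>i j. F (matrix_inv ?L) $ i $ j > 0"
    using * s by (auto simp: first_category_iff)
  have between: "invertible C \<and> (\<forall>i j. F (matrix_inv C) $ i $ j > 0)"
    if C: "C \<in> interval_hull A B" for C
  proof -
    \<comment> \<open>Since \<open>s\<^sub>i s\<^sub>j\<close> squares to 1, it cancels in front of
      the radius: \<open>F ?U\<close> and \<open>F ?L\<close> are the image of the center minus and
      plus the radius.\<close>
    have bd: "F ?U $ i $ j \<le> F C $ i $ j \<and> F C $ i $ j \<le> F ?L $ i $ j" for i j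
    proof -
      have "\<bar>C $ i $ j - I_center A B $ i $ j\<bar> \<le> I_radius A B $ i $ j"
        using C by (simp add: mem_interval_hull_iff)
      then show ?thesis by (auto simp: F_def s_def I_vec_nth I_P_nth abs_le_iff)
    qed
    have FC: "invertible (F C) \<and> (\<forall>i j. matrix_inv (F C) $ i $ j > 0)"
      by (rule inverse_positive_between[where P = "F ?U" and Q = "F ?L"
            and P' = "F (matrix_inv ?U)" and Q' = "F (matrix_inv ?L)"])
        (use U L bd in \<open>auto intro: F_mult matrix_inv_inverse inv\<close>)
    then have "C ** F (matrix_inv (F C)) = mat 1"
      using F_mult[OF matrix_inv_inverse(1)] F_F by metis
    then have C1: "F (matrix_inv (F C)) ** C = mat 1" "invertible C"
      using matrix_left_right_inverse invertible_right_inverse by blast+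
    \<comment> \<open>Both are left inverses of the invertible \<open>C\<close>, hence
      equal.\<close>
    then have "F (matrix_inv (F C)) = matrix_inv C"
      by (metis matrix_inv_inverse(1) matrix_mul_assoc matrix_mul_lid matrix_mul_rid)
    then have "F (matrix_inv C) = matrix_inv (F C)" using F_F by metis
    with FC C1 show ?thesis by simp
  qed
  fix C assume C: "C \<in> interval_hull A B"
  \<comment> \<open>The segment from \<open>?L\<close> to \<open>C\<close> stays in the hull, where
    \<open>between\<close> excludes singular matrices.\<close>
  have "det ?L * det C > 0"
    using between convex_interval_hull[OF I_vec_in_interval_hull[OF s] C]
    by (intro det_same_sign_segment) (simp add: invertible_det_nz)
  then have "det C < 0"
    using L(1) by (auto simp: almost_P_matrix_def zero_less_mult_iff)
  \<comment> \<open>Every subset of a proper \<open>K\<close> is proper, so the minors of each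
    \<open>I_vec A B z\<close> that are needed are covered by the almost P condition, or are the
    empty minor.\<close>
  moreover have "principal_minor C K > 0" if "K \<noteq> UNIV" for K
  proof (rule principal_minor_interval_hull_pos[OF C])
    fix z :: "real^'n" and L
    assume "\<forall>i. z $ i \<in> {-1, 1}" "L \<subseteq> K"
    then have "almost_P_matrix (I_vec A B z)" using * by (simp add: first_category_iff)
    moreover have "L \<noteq> UNIV" using that \<open>L \<subseteq> K\<close> by auto
    ultimately show "principal_minor (I_vec A B z) L > 0"
      by (cases "L = {}") (auto simp: almost_P_matrix_def)
  qed
  ultimately have "almost_P_matrix C"
    using L(1) by (simp add: almost_P_matrix_def)
  then show "almost_P_matrix_first_category J C"
    using between[OF C] by (simp add: first_category_iff)
qed (use I_P_in_interval_hull I_vec_in_interval_hull in blast)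

end
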